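(* Let $\nu\in(0,1)$ be any real number and put $\tau_0=\frac{1-\nu}{9L}$. Suppose the time step satisfies $0<\tau\le\tau_0$. Let $(u^n_{i,j})$ and $(\widetilde u^n_{i,j})$ be two numerical solutions of the scheme $$\mathscr{B}^{\alpha}_x\mathscr{B}^{\beta}_yD_t^{(2)}u^{n}_{i,j}+\tau^2\sigma_n^2\delta^{\alpha}_x\delta^{\beta}_yD_t^{(2)}u^{n}_{i,j}=\mathscr{B}^{\beta}_y\delta^{\alpha}_xu^{n}_{i,j}+\mathscr{B}^{\alpha}_x\delta^{\beta}_yu^{n}_{i,j}+\mathscr{B}^{\alpha}_x\mathscr{B}^{\beta}_yg^n_{i,j},\qquad (x_i,y_j)\in\Omega_h,\ 1\le n\le N,$$ with $u^n_{i,j}=0$ for $(x_i,y_j)\in\partial\Omega_h$, $1\le n\le N$, started from two (possibly different) initial grid functions $u^0$ and $\widetilde u^0$ that vanish on $\partial\Omega_h$ (the scheme for $\widetilde u$ is the same with $u$ replaced by $\widetilde u$ everywhere, including in $g^n_{i,j}$). Let $E^n_{i,j}=u^n_{i,j}-\widetilde u^n_{i,j}$. Then the scheme is stable in the sense that $$\lVert E^n\rVert\le\frac{3}{\nu}\,e^{\frac{18}{\nu}LT}\,\Big\lVert\Big(I+\frac{23}{18}\tau^2\delta^{\alpha}_x\delta^{\beta}_y\Big)E^0\Big\rVert,\qquad 1\le n\le N.$$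
   Context: Parameters: $1<\alpha,\beta<2$; $\kappa_1,\kappa_2>0$; $\Omega=(a,b)\times(c,d)$; $T>0$. The function $g(x,y,t,u)$, defined for $(x,y)\in\overline\Omega$, $t\in[0,T]$, $u\in\mathbb{R}$, satisfies $|g(x,y,t,u)-g(x,y,t,v)|\le L|u-v|$ for all $u,v\in\mathbb{R}$, with Lipschitz constant $L>0$. Grid: $x_i=a+ih_x$ ($0\le i\le M_1$), $y_j=c+jh_y$ ($0\le j\le M_2$), $t_n=n\tau$ ($0\le n\le N$), with $h_x=(b-a)/M_1$, $h_y=(d-c)/M_2$, $\tau=T/N$. $\overline\Omega_h$ is the set of all grid points $(x_i,y_j)$, $\Omega_h=\overline\Omega_h\cap\Omega$ (interior points, $1\le i\le M_1-1$, $1\le j\le M_2-1$), $\partial\Omega_h=\overline\Omega_h\cap\partial\Omega$. Coefficients: for $\gamma\in\{\alpha,\beta\}$, $g^{(\gamma)}_0=\frac{\Gamma(\gamma+1)}{\Gamma(\gamma/2+1)^2}$, $g^{(\gamma)}_k=\big(1-\frac{\gamma+1}{\gamma/2+k}\big)g^{(\gamma)}_{k-1}$, $g^{(\gamma)}_{-k}=g^{(\gamma)}_k$ for $k\ge1$; and $c_2^\gamma=\gamma/24$. Difference operators on grid functions $v=(v_{i,j})_{0\le i\le M_1,0\le j\le M_2}$: $(\delta^\alpha_xv)_{i,j}=-\frac{\kappa_1}{h_x^\alpha}\sum_{k=i-M_1}^{i}g^{(\alpha)}_kv_{i-k,j}$ for $1\le i\le M_1-1$; $(\delta^\beta_yv)_{i,j}=-\frac{\kappa_2}{h_y^\beta}\sum_{k=j-M_2}^{j}g^{(\beta)}_kv_{i,j-k}$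 for $1\le j\le M_2-1$. Compact operators: $(\mathscr{B}^\alpha_xv)_{i,j}=c_2^\alpha v_{i-1,j}+(1-2c_2^\alpha)v_{i,j}+c_2^\alpha v_{i+1,j}$ for $1\le i\le M_1-1$ and $(\mathscr{B}^\alpha_xv)_{i,j}=v_{i,j}$ for $i\in\{0,M_1\}$; $(\mathscr{B}^\beta_yv)_{i,j}=c_2^\beta v_{i,j-1}+(1-2c_2^\beta)v_{i,j}+c_2^\beta v_{i,j+1}$ for $1\le j\le M_2-1$ and $(\mathscr{B}^\beta_yv)_{i,j}=v_{i,j}$ for $j\in\{0,M_2\}$. BDF2 operator: $D_t^{(2)}v^1=\frac{v^1-v^0}{\tau}$ and, for $n\ge2$, $D_t^{(2)}v^n=\frac32\cdot\frac{v^n-v^{n-1}}{\tau}-\frac12\cdot\frac{v^{n-1}-v^{n-2}}{\tau}$. Also $\sigma_1=1$ and $\sigma_n=\frac23$ for $n\ge2$. Linearized source: $g^1_{i,j}=g(x_i,y_j,t_1,u^0_{i,j})$ and $g^n_{i,j}=g(x_i,y_j,t_n,2u^{n-1}_{i,j}-u^{n-2}_{i,j})$ for $n\ge2$, at all grid points $0\le i\le M_1$, $0\le j\le M_2$. Norm: $\lVert v\rVert=\big(h_xh_y\sum_{i=1}^{M_1-1}\sum_{j=1}^{M_2-1}v_{i,j}^2\big)^{1/2}$. $I$ is the identity operator. *)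

theory Defs
  imports "HOL-Analysis.Analysis"
begin

(* A grid function assigns v i j to the node (x_i, y_j); only the values with
   i \<le> M1 and j \<le> M2 are meaningful. *)
type_synonym grid_fun = "nat \<Rightarrow> nat \<Rightarrow> real"

definition node :: "real \<Rightarrow> real \<Rightarrow> nat \<Rightarrow> real" where
  "node x0 h i = x0 + real i * h"

fun frac_coeff_nat :: "real \<Rightarrow> nat \<Rightarrow> real" where
  "frac_coeff_nat \<gamma> 0 = Gamma (\<gamma> + 1) / (Gamma (\<gamma> / 2 + 1))\<^sup>2"
| "frac_coeff_nat \<gamma> (Suc k) = (1 - (\<gamma> + 1) / (\<gamma> / 2 + real (Suc k))) * frac_coeff_nat \<gamma> k"

definition frac_coeff :: "real \<Rightarrow> int \<Rightarrow> real" where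
  "frac_coeff \<gamma> k = frac_coeff_nat \<gamma> (nat \<bar>k\<bar>)"

definition c2 :: "real \<Rightarrow> real" where
  "c2 \<gamma> = \<gamma> / 24"

(* The difference operators delta_x and delta_y are only meant for 0 < i < M1 and
   0 < j < M2, respectively; the other index is unrestricted.  In the scheme and in
   the norm below they are never evaluated elsewhere. *)
definition delta_x :: "real \<Rightarrow> real \<Rightarrow> real \<Rightarrow> nat \<Rightarrow> grid_fun \<Rightarrow> grid_fun" where
  "delta_x \<kappa> \<alpha> h M1 v = (\<lambda>i j.
     - (\<kappa> / h powr \<alpha>) * (\<Sum>k = int i - int M1..int i. frac_coeff \<alpha> k * v (nat (int i - k)) j))"

definition delta_y :: "real \<Rightarrow> real \<Rightarrow> real \<Rightarrow> nat \<Rightarrow> grid_fun \<Rightarrow> grid_fun" where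
  "delta_y \<kappa> \<beta> h M2 v = (\<lambda>i j.
     - (\<kappa> / h powr \<beta>) * (\<Sum>k = int j - int M2..int j. frac_coeff \<beta> k * v i (nat (int j - k))))"

definition compact_x :: "real \<Rightarrow> nat \<Rightarrow> grid_fun \<Rightarrow> grid_fun" where
  "compact_x \<alpha> M1 v = (\<lambda>i j.
     if 0 < i \<and> i < M1
     then c2 \<alpha> * v (i - 1) j + (1 - 2 * c2 \<alpha>) * v i j + c2 \<alpha> * v (i + 1) j
     else v i j)"

definition compact_y :: "real \<Rightarrow> nat \<Rightarrow> grid_fun \<Rightarrow> grid_fun" where
  "compact_y \<beta> M2 v = (\<lambda>i j.
     if 0 < j \<and> j < M2
     then c2 \<beta> * v i (j - 1) + (1 - 2 * c2 \<beta>) * v i j + c2 \<beta> * v i (j + 1)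
     else v i j)"

(* Sequences of grid functions carry the time level as first argument.  The time-stepping
   operator and sources below are only meant for n \<ge> 1. *)
definition bdf2 :: "real \<Rightarrow> (nat \<Rightarrow> grid_fun) \<Rightarrow> nat \<Rightarrow> grid_fun" where
  "bdf2 \<tau> v n = (\<lambda>i j.
     if n = 1 then (v 1 i j - v 0 i j) / \<tau>
     else 3 / 2 * ((v n i j - v (n - 1) i j) / \<tau>) - 1 / 2 * ((v (n - 1) i j - v (n - 2) i j) / \<tau>))"

definition sigma :: "nat \<Rightarrow> real" where
  "sigma n = (if n = 1 then 1 else 2 / 3)"

definition lin_source ::
  "(real \<Rightarrow> real \<Rightarrow> real \<Rightarrow> real \<Rightarrow> real) \<Rightarrow> real \<Rightarrow> real \<Rightarrow> real \<Rightarrow> real \<Rightarrow> real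
    \<Rightarrow> (nat \<Rightarrow> grid_fun) \<Rightarrow> nat \<Rightarrow> grid_fun" where
  "lin_source g a c hx hy \<tau> u n = (\<lambda>i j.
     g (node a hx i) (node c hy j) (node 0 \<tau> n)
       (if n = 1 then u 0 i j else 2 * u (n - 1) i j - u (n - 2) i j))"

definition vanishes_on_boundary :: "nat \<Rightarrow> nat \<Rightarrow> grid_fun \<Rightarrow> bool" where
  "vanishes_on_boundary M1 M2 v \<longleftrightarrow>
     (\<forall>i\<le>M1. \<forall>j\<le>M2. i = 0 \<or> i = M1 \<or> j = 0 \<or> j = M2 \<longrightarrow> v i j = 0)"

definition grid_norm :: "real \<Rightarrow> real \<Rightarrow> nat \<Rightarrow> nat \<Rightarrow> grid_fun \<Rightarrow> real" where
  "grid_norm hx hy M1 M2 v = sqrt (hx * hy * (\<Sum>i = 1..M1 - 1. \<Sum>j = 1..M2 - 1. (v i j)\<^sup>2))"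

definition scheme_solution ::
  "real \<Rightarrow> real \<Rightarrow> real \<Rightarrow> real \<Rightarrow> real \<Rightarrow> nat \<Rightarrow> nat \<Rightarrow> nat \<Rightarrow> real \<Rightarrow> real \<Rightarrow> real \<Rightarrow> real
    \<Rightarrow> (real \<Rightarrow> real \<Rightarrow> real \<Rightarrow> real \<Rightarrow> real) \<Rightarrow> (nat \<Rightarrow> grid_fun) \<Rightarrow> bool" where
  "scheme_solution a c hx hy \<tau> M1 M2 N \<alpha> \<beta> \<kappa>1 \<kappa>2 g u \<longleftrightarrow>
     (let Bx = compact_x \<alpha> M1; By = compact_y \<beta> M2;
          Dx = delta_x \<kappa>1 \<alpha> hx M1; Dy = delta_y \<kappa>2 \<beta> hy M2
      in \<forall>n\<in>{1..N}.
           (\<forall>i j. 0 < i \<and> i < M1 \<and> 0 < j \<and> j < M2 \<longrightarrow>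
              Bx (By (bdf2 \<tau> u n)) i j + \<tau>\<^sup>2 * (sigma n)\<^sup>2 * Dx (Dy (bdf2 \<tau> u n)) i j
              = By (Dx (u n)) i j + Bx (Dy (u n)) i j
                + Bx (By (lin_source g a c hx hy \<tau> u n)) i j)
           \<and> vanishes_on_boundary M1 M2 (u n))"

end

theory Submission
  imports Defs
begin

text \<open>
  Energy method. On interior grid functions every operator of the scheme is a tensor product of
  symmetric, diagonally dominant kernels, and such tensor products are positive semidefinite. So
  testing the error equation with \<open>E n\<close> discards the diffusion terms and leaves the BDF2
  difference in the inner product \<open>W = A + (4/9) \<tau>\<^sup>2 C\<close>, where \<open>A\<close> comes from the two compact
  operators and \<open>C\<close> from the product of the two fractional differences. G-stability of BDF2 makes
  \<open>y n = (W (E n) (E n) + W (2 E n - E (n-1)) (2 E n - E (n-1)))\<^sup>1\<^sup>/\<^sup>2\<close> grow at most by a factor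
  \<open>1 + 6 L \<tau>\<close> per step, because the extrapolated source is controlled by \<open>y (n-1)\<close> itself.
  The first (Euler) step gives \<open>y 1 \<le> 2 R\<close>, with \<open>R\<close> the norm of the modified initial error,
  and \<open>A \<ge> 4/9\<close> costs a last factor \<open>3/2\<close>.
\<close>

section \<open>Positive semidefinite forms on grid functions\<close>

text \<open>Only semidefiniteness is asked: the forms used later read interior values alone, so they
  vanish on functions supported on the boundary. Linearity is stated in the first argument, and
  symmetry carries it to the second.\<close>

locale psd_form =
  fixes B :: "('a \<Rightarrow> 'b \<Rightarrow> real) \<Rightarrow> ('a \<Rightarrow> 'b \<Rightarrow> real) \<Rightarrow> real"
  assumes lin: "B (\<lambda>i j. x * v i j + y * w i j) z = x * B v z + y * B w z"
    and sym: "B v w = B w v"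
    and nonneg: "0 \<le> B v v"
begin

lemma lin_right: "B z (\<lambda>i j. x * v i j + y * w i j) = x * B z v + y * B z w"
  using lin sym by metis

lemma lin_diff: "B (\<lambda>i j. v i j - w i j) z = B v z - B w z"
  using lin[of 1 v "-1" w z] by simp

lemma lin_scale: "B (\<lambda>i j. x * v i j) z = x * B v z"
  using lin[of x v 0 v z] by simp

lemma square_comb:
  "B (\<lambda>i j. x * v i j + y * w i j) (\<lambda>i j. x * v i j + y * w i j)
     = x\<^sup>2 * B v v + 2 * x * y * B v w + y\<^sup>2 * B w w"
  by (simp add: lin lin_right sym[of w v] algebra_simps power2_eq_square)

text \<open>Every combination \<open>x * v + y * w\<close> has a nonnegative square, and suitable
  weights turn this into the claim. As the form may be degenerate, \<open>B w w = 0\<close> is a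
  case of its own.\<close>

lemma cauchy_schwarz: "(B v w)\<^sup>2 \<le> B v v * B w w"
proof -
  have *: "0 \<le> x\<^sup>2 * B v v + 2 * x * y * B v w + y\<^sup>2 * B w w" for x y
    using nonneg[of "\<lambda>i j. x * v i j + y * w i j"] unfolding square_comb .
  show ?thesis
  proof (cases "B w w = 0")
    case False
    then have pos: "0 < B w w"
      using nonneg[of w] by simp
    \<comment> \<open>The weights \<open>x = B w w\<close> and \<open>y = - B v w\<close> let
      \<open>B w w\<close> factor out of the quadratic, to be cancelled next.\<close>
    have "0 \<le> B w w * (B v v * B w w - (B v w)\<^sup>2)"
      using *[of "B w w" "- B v w"] by (simp add: algebra_simps power2_eq_square)
    then show ?thesis
      using pos by (simp add: zero_le_mult_iff)
  next
    case True
    have "B v w = 0"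
    proof (rule ccontr)
      assume nz: "B v w \<noteq> 0"
      \<comment> \<open>For \<open>B w w = 0\<close> the quadratic is affine in \<open>y\<close>;
        this witness gives it the value -1.\<close>
      show False
        using *[of 1 "- (B v v + 1) / (2 * B v w)"] True nz nonneg[of v]
        by (simp add: field_simps)
    qed
    then show ?thesis
      using True by simp
  qed
qed

lemma cauchy_schwarz_sqrt: "B v w \<le> sqrt (B v v) * sqrt (B w w)"
proof -
  have "B v w \<le> sqrt ((B v w)\<^sup>2)" by simp
  also have "\<dots> \<le> sqrt (B v v * B w w)"
    using cauchy_schwarz by (rule real_sqrt_le_mono)
  finally show ?thesis by (simp add: real_sqrt_mult)
qed

text \<open>Four times Dahlquist's G-norm for BDF2, with matrix (5, -2; -2, 1). The extrapolation
  \<open>2 * v - w\<close> stays visible because the source of the next step is evaluated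
  there.\<close>

definition bdf2_energy :: "('a \<Rightarrow> 'b \<Rightarrow> real) \<Rightarrow> ('a \<Rightarrow> 'b \<Rightarrow> real) \<Rightarrow> real" where
  "bdf2_energy v w = B v v + B (\<lambda>i j. 2 * v i j - w i j) (\<lambda>i j. 2 * v i j - w i j)"

lemma extrapolation_square:
  "B (\<lambda>i j. 2 * v i j - w i j) (\<lambda>i j. 2 * v i j - w i j) = 4 * B v v - 4 * B v w + B w w"
  using square_comb[of 2 v "-1" w] by simp

lemma bdf2_energy_nonneg: "0 \<le> bdf2_energy v w"
  unfolding bdf2_energy_def using nonneg by (simp add: add_nonneg_nonneg)

text \<open>G-stability of BDF2: the deficit is the square of the second difference.\<close>

lemma bdf2_energy_step:
  "bdf2_energy v w - bdf2_energy w z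
     \<le> 4 * B (\<lambda>i j. 3 / 2 * v i j - 2 * w i j + 1 / 2 * z i j) v"
proof -
  \<comment> \<open>Three-term combinations are bracketed as nested two-term ones, the shape that
    \<open>lin\<close> rewrites.\<close>
  have e: "(\<lambda>i j. 3 / 2 * v i j - 2 * w i j + 1 / 2 * z i j)
      = (\<lambda>i j. 1 * (3 / 2 * v i j + (-2) * w i j) + 1 / 2 * z i j)"
    by simp
  have "B (\<lambda>i j. 3 / 2 * v i j - 2 * w i j + 1 / 2 * z i j) v
      = 3 / 2 * B v v - 2 * B w v + 1 / 2 * B z v"
    unfolding e lin by simp
  moreover have "0 \<le> B (\<lambda>i j. 1 * (1 * v i j + (-2) * w i j) + 1 * z i j)
      (\<lambda>i j. 1 * (1 * v i j + (-2) * w i j) + 1 * z i j)"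
    by (rule nonneg)
  then have "0 \<le> B v v + 4 * B w w + B z z - 4 * B v w + 2 * B v z - 4 * B w z"
    unfolding lin lin_right by (simp add: sym[of w v] sym[of z v] sym[of z w])
  ultimately show ?thesis
    unfolding bdf2_energy_def extrapolation_square
    by (simp add: sym[of w v] sym[of z v])
qed

end

lemma psd_form_add_scaled:
  assumes "psd_form A" "psd_form C" "0 \<le> s"
  shows "psd_form (\<lambda>v w. A v w + s * C v w)"
proof -
  interpret A: psd_form A by fact
  interpret C: psd_form C by fact
  show ?thesis
  proof
    show "A v w + s * C v w = A w v + s * C w v" for v w
      using A.sym[of v w] C.sym[of v w] by simp
  qed (use assms(3) in \<open>auto simp: A.lin C.lin A.nonneg C.nonneg algebra_simps\<close>)
qed

section \<open>Diagonally dominant kernels\<close>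

definition diag_dominant :: "'a set \<Rightarrow> ('a \<Rightarrow> 'a \<Rightarrow> real) \<Rightarrow> bool" where
  "diag_dominant I K \<longleftrightarrow> (\<forall>i\<in>I. \<forall>p\<in>I. K i p = K p i)
     \<and> (\<forall>i\<in>I. (\<Sum>p\<in>I - {i}. \<bar>K i p\<bar>) \<le> K i i)"

text \<open>A Gershgorin argument: each off-diagonal term is at least
  \<open>- \<bar>K i p\<bar> * (b i i + b p p) / 2\<close>; by symmetry of \<open>K\<close> both
  halves have the same total, which the diagonal dominates. The array \<open>b\<close> is more
  general than a product \<open>x i * x p\<close>, so that its entries may themselves be values of a
  form; this is what tensor products require.\<close>

lemma diag_dominant_nonneg:
  assumes fin: "finite I" and K: "diag_dominant I K"
    and b: "\<And>i p. i \<in> I \<Longrightarrow> p \<in> I \<Longrightarrow> 2 * \<bar>b i p\<bar> \<le> b i i + b p p"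
  shows "0 \<le> (\<Sum>i\<in>I. \<Sum>p\<in>I. K i p * b i p)"
proof -
  have b0: "0 \<le> b i i" if "i \<in> I" for i
    using b[OF that that] by simp
  have "(\<Sum>i\<in>I. \<Sum>p\<in>I. K i p * b i p) = (\<Sum>i\<in>I. K i i * b i i) + (\<Sum>i\<in>I. \<Sum>p\<in>I - {i}. K i p * b i p)"
    by (simp add: sum.remove[OF fin] flip: sum.distrib cong: sum.cong)
  moreover have "(\<Sum>i\<in>I. \<Sum>p\<in>I - {i}. K i p * b i p)
      \<ge> - (\<Sum>i\<in>I. \<Sum>p\<in>I - {i}. \<bar>K i p\<bar> * ((b i i + b p p) / 2))"
    unfolding sum_negf[symmetric]
  proof (intro sum_mono)
    fix i p assume "i \<in> I" "p \<in> I - {i}"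
    then have "\<bar>K i p * b i p\<bar> \<le> \<bar>K i p\<bar> * ((b i i + b p p) / 2)"
      unfolding abs_mult using b[of i p] by (intro mult_left_mono) auto
    then show "- (\<bar>K i p\<bar> * ((b i i + b p p) / 2)) \<le> K i p * b i p"
      by linarith
  qed
  moreover have "(\<Sum>i\<in>I. \<Sum>p\<in>I - {i}. \<bar>K i p\<bar> * ((b i i + b p p) / 2))
      = (\<Sum>i\<in>I. (\<Sum>p\<in>I - {i}. \<bar>K i p\<bar>) * b i i)"
  proof -
    \<comment> \<open>Putting zeros on the diagonal makes the index set a full square, on which the
      order of summation can be exchanged.\<close>
    let ?k = "\<lambda>i p. if p = i then 0 else \<bar>K i p\<bar>"
    have restrict: "(\<Sum>p\<in>I - {i}. \<bar>K i p\<bar> * f p) = (\<Sum>p\<in>I. ?k i p * f p)" for i f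
      by (rule sum.mono_neutral_cong_left) (use fin in auto)
    have swap: "(\<Sum>i\<in>I. \<Sum>p\<in>I. ?k i p * b p p) = (\<Sum>i\<in>I. \<Sum>p\<in>I. ?k i p * b i i)"
      by (subst sum.swap) (use K in \<open>auto simp: diag_dominant_def intro!: sum.cong\<close>)
    have "(\<Sum>i\<in>I. \<Sum>p\<in>I - {i}. \<bar>K i p\<bar> * ((b i i + b p p) / 2))
        = ((\<Sum>i\<in>I. \<Sum>p\<in>I. ?k i p * b i i) + (\<Sum>i\<in>I. \<Sum>p\<in>I. ?k i p * b p p)) / 2"
      unfolding restrict sum.distrib[symmetric] sum_divide_distrib
      by (intro sum.cong) (auto simp: algebra_simps add_divide_distrib)
    also have "\<dots> = (\<Sum>i\<in>I. \<Sum>p\<in>I. ?k i p * b i i)"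
      unfolding swap by simp
    also have "\<dots> = (\<Sum>i\<in>I. (\<Sum>p\<in>I - {i}. \<bar>K i p\<bar>) * b i i)"
      unfolding restrict[symmetric] sum_distrib_right ..
    finally show ?thesis .
  qed
  moreover have "(\<Sum>i\<in>I. (\<Sum>p\<in>I - {i}. \<bar>K i p\<bar>) * b i i) \<le> (\<Sum>i\<in>I. K i i * b i i)"
    using K b0 by (intro sum_mono mult_right_mono) (auto simp: diag_dominant_def)
  ultimately show ?thesis by linarith
qed

lemma diag_dominant_quadratic_nonneg:
  assumes "finite I" "diag_dominant I K"
  shows "0 \<le> (\<Sum>i\<in>I. \<Sum>p\<in>I. K i p * (x i * x p))"
proof (rule diag_dominant_nonneg[OF assms])
  fix i p
  show "2 * \<bar>x i * x p\<bar> \<le> x i * x i + x p * x p"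
    using sum_squares_bound[of "x i" "x p"] sum_squares_bound[of "x i" "- x p"]
    by (auto simp: abs_if power2_eq_square)
qed

section \<open>Tensor products of kernels\<close>

definition tensor_apply where
  "tensor_apply I J K H v i j = (\<Sum>p\<in>I. \<Sum>q\<in>J. K i p * H j q * v p q :: real)"

definition tensor_form where
  "tensor_form I J K H v w = (\<Sum>i\<in>I. \<Sum>j\<in>J. tensor_apply I J K H v i j * w i j :: real)"

text \<open>Regrouped so that \<open>K\<close> acts on the array of \<open>H\<close>-products of
  rows, the shape \<open>diag_dominant_nonneg\<close> expects.\<close>

lemma tensor_form_alt:
  "tensor_form I J K H v w = (\<Sum>i\<in>I. \<Sum>p\<in>I. K i p * (\<Sum>j\<in>J. \<Sum>q\<in>J. H j q * (w i j * v p q)))"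
proof -
  have "tensor_form I J K H v w
      = (\<Sum>i\<in>I. \<Sum>j\<in>J. \<Sum>p\<in>I. \<Sum>q\<in>J. K i p * (H j q * (w i j * v p q)))"
    unfolding tensor_form_def tensor_apply_def sum_distrib_right
    by (simp add: mult_ac)
  also have "\<dots> = (\<Sum>i\<in>I. \<Sum>p\<in>I. \<Sum>j\<in>J. \<Sum>q\<in>J. K i p * (H j q * (w i j * v p q)))"
    by (intro sum.cong refl sum.swap)
  finally show ?thesis by (simp add: sum_distrib_left)
qed

text \<open>Dominance is used twice. In the second index it makes the \<open>H\<close>-form of a row
  nonnegative, so the \<open>H\<close>-products of rows obey the Gram-type bound that the argument
  in the first index needs. No eigenvectors or square roots of kernels enter.\<close>

lemma psd_tensor_form:
  assumes I: "finite I" "diag_dominant I K" and J: "finite J" "diag_dominant J H"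
  shows "psd_form (tensor_form I J K H)"
proof
  fix x y :: real and v w z
  show "tensor_form I J K H (\<lambda>i j. x * v i j + y * w i j) z
      = x * tensor_form I J K H v z + y * tensor_form I J K H w z"
    unfolding tensor_form_def tensor_apply_def sum_distrib_left sum_distrib_right
      sum.distrib[symmetric]
    by (intro sum.cong refl) (simp add: algebra_simps)
  have K: "K i p = K p i" if "i \<in> I" "p \<in> I" for i p
    using I that by (auto simp: diag_dominant_def)
  have H: "H j q = H q j" if "j \<in> J" "q \<in> J" for j q
    using J that by (auto simp: diag_dominant_def)
  have inner: "(\<Sum>j\<in>J. \<Sum>q\<in>J. H j q * (s j * t q)) = (\<Sum>j\<in>J. \<Sum>q\<in>J. H j q * (t j * s q))" for s t
    by (subst sum.swap) (auto intro!: sum.cong simp: H)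
  show "tensor_form I J K H v w = tensor_form I J K H w v"
    unfolding tensor_form_alt
    by (subst sum.swap, subst inner) (auto intro!: sum.cong simp: K)
  show "0 \<le> tensor_form I J K H v v"
    unfolding tensor_form_alt
  proof (rule diag_dominant_nonneg[OF I])
    fix i p
    let ?b = "\<lambda>i p. \<Sum>j\<in>J. \<Sum>q\<in>J. H j q * (v i j * v p q)"
    \<comment> \<open>The \<open>H\<close>-form of the sum (\<open>s = 1\<close>) and of the
      difference (\<open>s = -1\<close>) of rows \<open>i\<close> and \<open>p\<close> bounds the
      mixed term from both sides.\<close>
    have expand: "0 \<le> ?b i i + ?b p p + 2 * s * ?b i p" if "s\<^sup>2 = 1" for s
    proof -
      have "0 \<le> (\<Sum>j\<in>J. \<Sum>q\<in>J. H j q * ((v i j + s * v p j) * (v i q + s * v p q)))"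
        by (rule diag_dominant_quadratic_nonneg[OF J])
      also have "\<dots> = ?b i i + s\<^sup>2 * ?b p p + s * ?b i p + s * ?b p i"
        unfolding sum_distrib_left sum.distrib[symmetric]
        by (intro sum.cong refl) (simp add: algebra_simps power2_eq_square)
      also have "?b p i = ?b i p"
        by (rule inner)
      finally show ?thesis using that by simp
    qed
    show "2 * \<bar>?b i p\<bar> \<le> ?b i i + ?b p p"
      using expand[of 1] expand[of "-1"] by (auto simp: abs_if)
  qed
qed

lemma tensor_form_diff_left:
  "tensor_form I J (\<lambda>i p. K i p - x * K' i p) H v w
     = tensor_form I J K H v w - x * tensor_form I J K' H v w"
  unfolding tensor_form_def tensor_apply_def sum_distrib_left sum_distrib_right
    sum_subtractf[symmetric]
  by (intro sum.cong refl) (simp add: algebra_simps)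

lemma tensor_form_diff_right:
  "tensor_form I J K (\<lambda>j q. H j q - x * H' j q) v w
     = tensor_form I J K H v w - x * tensor_form I J K H' v w"
  unfolding tensor_form_def tensor_apply_def sum_distrib_left sum_distrib_right
    sum_subtractf[symmetric]
  by (intro sum.cong refl) (simp add: algebra_simps)

definition id_kernel :: "'a \<Rightarrow> 'a \<Rightarrow> real" where
  "id_kernel i p = (if i = p then 1 else 0)"

lemma diag_dominant_id_kernel: "diag_dominant I id_kernel"
proof -
  have "(\<Sum>p\<in>I - {i}. \<bar>id_kernel i p\<bar>) = 0" for i
    by (rule sum.neutral) (auto simp: id_kernel_def)
  then show ?thesis
    unfolding diag_dominant_def by (auto simp: id_kernel_def)
qed

lemma tensor_form_id:
  assumes "finite I" "finite J"
  shows "tensor_form I J id_kernel id_kernel v w = (\<Sum>i\<in>I. \<Sum>j\<in>J. v i j * w i j)"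
proof -
  have "tensor_apply I J id_kernel id_kernel v i j = v i j" if "i \<in> I" "j \<in> J" for i j
  proof -
    have "tensor_apply I J id_kernel id_kernel v i j
        = (\<Sum>p\<in>I. if i = p then (\<Sum>q\<in>J. if j = q then v p q else 0) else 0)"
      unfolding tensor_apply_def id_kernel_def by (intro sum.cong refl) (auto intro!: sum.cong)
    then show ?thesis
      using assms that by simp
  qed
  then show ?thesis
    unfolding tensor_form_def by simp
qed

section \<open>The kernels of the scheme\<close>

lemma frac_coeff_nat_0_pos: "0 < \<gamma> \<Longrightarrow> 0 < frac_coeff_nat \<gamma> 0"
  unfolding frac_coeff_nat.simps by (intro divide_pos_pos zero_less_power Gamma_real_pos) auto

text \<open>The first recursion factor is negative. The later ones have numerator
  \<open>k - 1 - \<gamma> / 2\<close> with \<open>k\<close> at least 2, which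
  \<open>\<gamma> < 2\<close> keeps nonnegative, so the sign never changes again.\<close>

lemma frac_coeff_nat_Suc_nonpos:
  assumes "0 < \<gamma>" "\<gamma> < 2"
  shows "frac_coeff_nat \<gamma> (Suc k) \<le> 0"
proof (induction k)
  case 0
  have "1 - (\<gamma> + 1) / (\<gamma> / 2 + real (Suc 0)) \<le> 0"
    using assms by (simp add: field_simps)
  then show ?case
    unfolding frac_coeff_nat.simps(2)
    using assms by (intro mult_nonpos_nonneg less_imp_le[OF frac_coeff_nat_0_pos])
next
  case (Suc k)
  have "0 \<le> 1 - (\<gamma> + 1) / (\<gamma> / 2 + real (Suc (Suc k)))"
    using assms by (simp add: field_simps)
  then show ?case
    using Suc by (subst frac_coeff_nat.simps) (rule mult_nonneg_nonpos)
qed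

text \<open>The recursion, cleared of its denominator, telescopes. This closed form of the truncated
  symmetric sum replaces the limit argument that the full series sums to zero.\<close>

lemma frac_coeff_nat_partial_sum:
  assumes "0 < \<gamma>"
  shows "\<gamma> * (frac_coeff_nat \<gamma> 0 + 2 * (\<Sum>k=1..m. frac_coeff_nat \<gamma> k))
       = - frac_coeff_nat \<gamma> m * (2 * real m - \<gamma>)"
proof (induction m)
  case 0
  then show ?case by simp
next
  case (Suc m)
  have "frac_coeff_nat \<gamma> (Suc m) * (\<gamma> + 2 * real (Suc m)) = frac_coeff_nat \<gamma> m * (2 * real m - \<gamma>)"
  proof -
    have "\<gamma> / 2 + real (Suc m) \<noteq> 0"
      using assms by simp
    then have "(1 - (\<gamma> + 1) / (\<gamma> / 2 + real (Suc m))) * (\<gamma> + 2 * real (Suc m)) = 2 * real m - \<gamma>"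
      by (simp add: divide_simps) (simp add: algebra_simps)
    then show ?thesis by (simp del: of_nat_Suc)
  qed
  then show ?case
    using Suc by (simp add: algebra_simps del: frac_coeff_nat.simps)
qed

text \<open>For \<open>m\<close> at least 1 the closed form is nonnegative, since the last
  coefficient is nonpositive and \<open>2 * m > \<gamma>\<close>; all coefficients summed here share
  that sign.\<close>

lemma frac_coeff_nat_tail_bound:
  assumes "0 < \<gamma>" "\<gamma> < 2"
  shows "2 * (\<Sum>k=1..m. \<bar>frac_coeff_nat \<gamma> k\<bar>) \<le> frac_coeff_nat \<gamma> 0"
proof (cases m)
  case 0
  then show ?thesis
    using frac_coeff_nat_0_pos[OF assms(1)] by simp
next
  case (Suc l)
  have "0 \<le> - frac_coeff_nat \<gamma> m * (2 * real m - \<gamma>)"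
    using frac_coeff_nat_Suc_nonpos[OF assms, of l] assms Suc
    by (intro mult_nonneg_nonneg) (auto simp del: frac_coeff_nat.simps)
  then have "0 \<le> frac_coeff_nat \<gamma> 0 + 2 * (\<Sum>k=1..m. frac_coeff_nat \<gamma> k)"
    using frac_coeff_nat_partial_sum[OF assms(1), of m] assms(1)
    by (metis zero_le_mult_iff less_le_not_le)
  moreover have "(\<Sum>k=1..m. \<bar>frac_coeff_nat \<gamma> k\<bar>) = - (\<Sum>k=1..m. frac_coeff_nat \<gamma> k)"
    unfolding sum_negf[symmetric]
  proof (intro sum.cong refl)
    fix k assume "k \<in> {1..m}"
    then obtain l where "k = Suc l"
      by (cases k) auto
    then show "\<bar>frac_coeff_nat \<gamma> k\<bar> = - frac_coeff_nat \<gamma> k"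
      using frac_coeff_nat_Suc_nonpos[OF assms, of l] by (simp del: frac_coeff_nat.simps)
  qed
  ultimately show ?thesis by simp
qed

text \<open>The Toeplitz matrix of minus the fractional difference; the sign is chosen to make the
  diagonal positive.\<close>

definition frac_kernel :: "real \<Rightarrow> real \<Rightarrow> real \<Rightarrow> nat \<Rightarrow> nat \<Rightarrow> real" where
  "frac_kernel \<kappa> \<gamma> h i p = \<kappa> / h powr \<gamma> * frac_coeff \<gamma> (int i - int p)"

text \<open>Each side of the diagonal contributes at most one copy of the tail sum, and two copies
  fit under the central coefficient.\<close>

lemma diag_dominant_frac_kernel:
  assumes "0 < \<gamma>" "\<gamma> < 2" "0 \<le> \<kappa>"
  shows "diag_dominant {1..<M} (frac_kernel \<kappa> \<gamma> h)"
  unfolding diag_dominant_def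
proof (intro conjI ballI)
  fix i p
  show "frac_kernel \<kappa> \<gamma> h i p = frac_kernel \<kappa> \<gamma> h p i"
    by (simp add: frac_kernel_def frac_coeff_def abs_minus_commute)
next
  fix i assume i: "i \<in> {1..<M}"
  let ?f = "\<lambda>p. \<bar>frac_coeff \<gamma> (int i - int p)\<bar>"
  let ?s = "\<Sum>k=1..M. \<bar>frac_coeff_nat \<gamma> k\<bar>"
  have "(\<Sum>p\<in>{1..<i}. ?f p) = (\<Sum>k\<in>{1..<i}. \<bar>frac_coeff_nat \<gamma> k\<bar>)"
    by (rule sum.reindex_bij_witness[where i = "\<lambda>k. i - k" and j = "\<lambda>p. i - p"])
      (auto simp: frac_coeff_def nat_diff_distrib')
  also have "\<dots> \<le> ?s"
    using i by (intro sum_mono2) auto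
  finally have left: "(\<Sum>p\<in>{1..<i}. ?f p) \<le> ?s" .
  have "(\<Sum>p\<in>{i<..<M}. ?f p) = (\<Sum>k\<in>{1..<M - i}. \<bar>frac_coeff_nat \<gamma> k\<bar>)"
    by (rule sum.reindex_bij_witness[where i = "\<lambda>k. k + i" and j = "\<lambda>p. p - i"])
      (auto simp: frac_coeff_def nat_diff_distrib')
  also have "\<dots> \<le> ?s"
    using i by (intro sum_mono2) auto
  finally have right: "(\<Sum>p\<in>{i<..<M}. ?f p) \<le> ?s" .
  have "{1..<M} - {i} = {1..<i} \<union> {i<..<M}"
    using i by auto
  then have "(\<Sum>p\<in>{1..<M} - {i}. ?f p) = (\<Sum>p\<in>{1..<i} \<union> {i<..<M}. ?f p)"
    by (rule arg_cong)
  also have "\<dots> = (\<Sum>p\<in>{1..<i}. ?f p) + (\<Sum>p\<in>{i<..<M}. ?f p)"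
    by (rule sum.union_disjoint) auto
  also have "\<dots> \<le> frac_coeff_nat \<gamma> 0"
    using left right frac_coeff_nat_tail_bound[OF assms(1,2), of M] by linarith
  finally have *: "(\<Sum>p\<in>{1..<M} - {i}. ?f p) \<le> frac_coeff_nat \<gamma> 0" .
  have "(\<Sum>p\<in>{1..<M} - {i}. \<bar>frac_kernel \<kappa> \<gamma> h i p\<bar>)
      = \<kappa> / h powr \<gamma> * (\<Sum>p\<in>{1..<M} - {i}. ?f p)"
    using assms by (simp add: frac_kernel_def abs_mult sum_distrib_left)
  also have "\<dots> \<le> \<kappa> / h powr \<gamma> * frac_coeff_nat \<gamma> 0"
    using * assms by (intro mult_left_mono) auto
  finally show "(\<Sum>p\<in>{1..<M} - {i}. \<bar>frac_kernel \<kappa> \<gamma> h i p\<bar>) \<le> frac_kernel \<kappa> \<gamma> h i i"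
    by (simp add: frac_kernel_def frac_coeff_def)
qed

section \<open>Compact kernels and their comparison with the identity\<close>

definition compact_kernel :: "real \<Rightarrow> nat \<Rightarrow> nat \<Rightarrow> real" where
  "compact_kernel \<gamma> i p =
     (if i = p then 1 - 2 * c2 \<gamma> else if p = i + 1 \<or> i = p + 1 then c2 \<gamma> else 0)"

lemma diag_dominant_tridiagonal:
  assumes "2 * \<bar>y\<bar> \<le> x"
  shows "diag_dominant {1..<M} (\<lambda>i p :: nat. if i = p then x else if p = i + 1 \<or> i = p + 1 then y else 0)"
    (is "diag_dominant _ ?K")
  unfolding diag_dominant_def
proof (intro conjI ballI)
  fix i assume "i \<in> {1..<M}"
  have "(\<Sum>p\<in>{1..<M} - {i}. \<bar>?K i p\<bar>) = (\<Sum>p\<in>({1..<M} - {i}) \<inter> {i - 1, i + 1}. \<bar>?K i p\<bar>)"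
    by (rule sum.mono_neutral_right) auto
  also have "\<dots> \<le> (\<Sum>p\<in>({1..<M} - {i}) \<inter> {i - 1, i + 1}. \<bar>y\<bar>)"
    by (intro sum_mono) auto
  also have "\<dots> \<le> (\<Sum>p\<in>{i - 1, i + 1}. \<bar>y\<bar>)"
    by (intro sum_mono2) auto
  also have "\<dots> \<le> 2 * \<bar>y\<bar>"
    by (cases i) auto
  finally show "(\<Sum>p\<in>{1..<M} - {i}. \<bar>?K i p\<bar>) \<le> ?K i i"
    using assms by simp
qed auto

text \<open>The constant 2/3 is where \<open>\<gamma> < 2\<close> enters: after the subtraction the
  diagonal \<open>1/3 - \<gamma>/12\<close> still dominates the two neighbours
  \<open>\<gamma>/24\<close>. The factor \<open>1 *\<close> matches the shape of
  \<open>tensor_form_diff_left\<close> and \<open>tensor_form_diff_right\<close>.\<close>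

lemma
  assumes "0 < \<gamma>" "\<gamma> < 2"
  shows diag_dominant_compact: "diag_dominant {1..<M} (compact_kernel \<gamma>)"
    and diag_dominant_compact_lower:
      "diag_dominant {1..<M} (\<lambda>i p. compact_kernel \<gamma> i p - 2 / 3 * id_kernel i p)"
    and diag_dominant_compact_upper:
      "diag_dominant {1..<M} (\<lambda>i p. id_kernel i p - 1 * compact_kernel \<gamma> i p)"
proof -
  have "compact_kernel \<gamma> = (\<lambda>i p. if i = p then 1 - 2 * c2 \<gamma> else if p = i + 1 \<or> i = p + 1 then c2 \<gamma> else 0)"
    by (auto simp: compact_kernel_def fun_eq_iff)
  then show "diag_dominant {1..<M} (compact_kernel \<gamma>)"
    using diag_dominant_tridiagonal[of "c2 \<gamma>" "1 - 2 * c2 \<gamma>" M] assms by (simp add: c2_def)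
  have "(\<lambda>i p. compact_kernel \<gamma> i p - 2 / 3 * id_kernel i p)
      = (\<lambda>i p. if i = p then 1 / 3 - 2 * c2 \<gamma> else if p = i + 1 \<or> i = p + 1 then c2 \<gamma> else 0)"
    by (auto simp: compact_kernel_def id_kernel_def fun_eq_iff)
  then show "diag_dominant {1..<M} (\<lambda>i p. compact_kernel \<gamma> i p - 2 / 3 * id_kernel i p)"
    using diag_dominant_tridiagonal[of "c2 \<gamma>" "1 / 3 - 2 * c2 \<gamma>" M] assms by (simp add: c2_def)
  have "(\<lambda>i p. id_kernel i p - 1 * compact_kernel \<gamma> i p)
      = (\<lambda>i p. if i = p then 2 * c2 \<gamma> else if p = i + 1 \<or> i = p + 1 then - c2 \<gamma> else 0)"
    by (auto simp: compact_kernel_def id_kernel_def fun_eq_iff)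
  then show "diag_dominant {1..<M} (\<lambda>i p. id_kernel i p - 1 * compact_kernel \<gamma> i p)"
    using diag_dominant_tridiagonal[of "- c2 \<gamma>" "2 * c2 \<gamma>" M] assms by (simp add: c2_def)
qed

text \<open>One direction is exchanged at a time, with \<open>id_kernel\<close> in the first and the
  compact kernel in the second index as intermediate form. Each exchange costs a factor 2/3 in the
  lower bound, hence 4/9, and nothing in the upper one.\<close>

lemma compact_form_bounds:
  fixes v :: grid_fun and M1 M2 :: nat
  assumes "0 < \<alpha>" "\<alpha> < 2" "0 < \<beta>" "\<beta> < 2"
  defines "A \<equiv> tensor_form {1..<M1} {1..<M2} (compact_kernel \<alpha>) (compact_kernel \<beta>) v v"
    and "S \<equiv> tensor_form {1..<M1} {1..<M2} id_kernel id_kernel v v"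
  shows "4 / 9 * S \<le> A" and "A \<le> S"
proof -
  note dd = diag_dominant_id_kernel diag_dominant_compact diag_dominant_compact_lower
    diag_dominant_compact_upper
  have nn: "0 \<le> tensor_form {1..<M1} {1..<M2} K H v v"
    if "diag_dominant {1..<M1} K" "diag_dominant {1..<M2} H" for K H
    by (rule psd_form.nonneg[OF psd_tensor_form]) (use that in auto)
  show "4 / 9 * S \<le> A"
    using nn[OF dd(3)[OF assms(1,2)] dd(2)[OF assms(3,4)]]
      nn[OF dd(1) dd(3)[OF assms(3,4)]]
    unfolding tensor_form_diff_left tensor_form_diff_right A_def S_def by linarith
  show "A \<le> S"
    using nn[OF dd(4)[OF assms(1,2)] dd(2)[OF assms(3,4)]]
      nn[OF dd(1) dd(4)[OF assms(3,4)]]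
    unfolding tensor_form_diff_left tensor_form_diff_right A_def S_def by linarith
qed

section \<open>The operators of the scheme as kernels on interior nodes\<close>

lemma compact_x_kernel:
  assumes i: "i \<in> {1..<M}" and v: "v 0 j = 0" "v M j = 0"
  shows "compact_x \<gamma> M v i j = (\<Sum>p\<in>{1..<M}. compact_kernel \<gamma> i p * v p j)"
proof -
  obtain l where l: "i = Suc l"
    using i by (cases i) auto
  have "(\<Sum>p\<in>{1..<M}. compact_kernel \<gamma> i p * v p j) = (\<Sum>p\<in>{..M}. compact_kernel \<gamma> i p * v p j)"
  proof (rule sum.mono_neutral_left)
    show "\<forall>p\<in>{..M} - {1..<M}. compact_kernel \<gamma> i p * v p j = 0"
    proof
      fix p assume "p \<in> {..M} - {1..<M}"
      then have "p = 0 \<or> p = M" by auto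
      then show "compact_kernel \<gamma> i p * v p j = 0" using v by auto
    qed
  qed auto
  also have "\<dots> = (\<Sum>p\<in>{l, Suc l, Suc (Suc l)}. compact_kernel \<gamma> i p * v p j)"
    using i l by (intro sum.mono_neutral_right) (auto simp: compact_kernel_def)
  also have "\<dots> = compact_x \<gamma> M v i j"
    using i l by (simp add: compact_kernel_def compact_x_def)
  finally show ?thesis by simp
qed

text \<open>The substitution \<open>p = i - k\<close> turns the convolution into a row sum over
  \<open>0..M\<close>, whose two end terms vanish.\<close>

lemma delta_x_kernel:
  assumes i: "i \<in> {1..<M}" and v: "v 0 j = 0" "v M j = 0"
  shows "delta_x \<kappa> \<gamma> h M v i j = - (\<Sum>p\<in>{1..<M}. frac_kernel \<kappa> \<gamma> h i p * v p j)"
proof -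
  have "(\<Sum>p\<in>{1..<M}. frac_coeff \<gamma> (int i - int p) * v p j)
      = (\<Sum>p\<in>{..M}. frac_coeff \<gamma> (int i - int p) * v p j)"
  proof (rule sum.mono_neutral_left)
    show "\<forall>p\<in>{..M} - {1..<M}. frac_coeff \<gamma> (int i - int p) * v p j = 0"
    proof
      fix p assume "p \<in> {..M} - {1..<M}"
      then have "p = 0 \<or> p = M" by auto
      then show "frac_coeff \<gamma> (int i - int p) * v p j = 0" using v by auto
    qed
  qed auto
  also have "\<dots> = (\<Sum>k = int i - int M..int i. frac_coeff \<gamma> k * v (nat (int i - k)) j)"
    by (rule sum.reindex_bij_witness[where i = "\<lambda>k. nat (int i - k)" and j = "\<lambda>p. int i - int p"])
      auto
  finally have "delta_x \<kappa> \<gamma> h M v i j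
      = - (\<kappa> / h powr \<gamma>) * (\<Sum>p\<in>{1..<M}. frac_coeff \<gamma> (int i - int p) * v p j)"
    by (simp add: delta_x_def)
  then show ?thesis
    by (simp add: frac_kernel_def sum_distrib_left mult.assoc sum_negf)
qed

lemma compact_y_transpose: "compact_y \<gamma> M v i j = compact_x \<gamma> M (\<lambda>q p. v p q) j i"
  by (simp add: compact_y_def compact_x_def)

lemma delta_y_transpose: "delta_y \<kappa> \<gamma> h M v i j = delta_x \<kappa> \<gamma> h M (\<lambda>q p. v p q) j i"
  by (simp add: delta_y_def delta_x_def)

lemma compact_x_diff:
  "compact_x \<gamma> M (\<lambda>i j. v i j - w i j) = (\<lambda>i j. compact_x \<gamma> M v i j - compact_x \<gamma> M w i j)"
  by (auto simp: compact_x_def fun_eq_iff algebra_simps)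

lemma delta_x_diff:
  "delta_x \<kappa> \<gamma> h M (\<lambda>i j. v i j - w i j) = (\<lambda>i j. delta_x \<kappa> \<gamma> h M v i j - delta_x \<kappa> \<gamma> h M w i j)"
  by (auto simp: delta_x_def fun_eq_iff right_diff_distrib sum_subtractf)

lemma compact_y_diff:
  "compact_y \<gamma> M (\<lambda>i j. v i j - w i j) = (\<lambda>i j. compact_y \<gamma> M v i j - compact_y \<gamma> M w i j)"
  by (simp add: compact_y_transpose compact_x_diff fun_eq_iff)

lemma delta_y_diff:
  "delta_y \<kappa> \<gamma> h M (\<lambda>i j. v i j - w i j) = (\<lambda>i j. delta_y \<kappa> \<gamma> h M v i j - delta_y \<kappa> \<gamma> h M w i j)"
  by (simp add: delta_y_transpose delta_x_diff fun_eq_iff)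

context
  fixes M1 M2 :: nat and v :: grid_fun and i j :: nat
  assumes v: "vanishes_on_boundary M1 M2 v" and i: "i \<in> {1..<M1}" and j: "j \<in> {1..<M2}"
begin

lemma boundary_values:
  "q \<le> M2 \<Longrightarrow> v 0 q = 0" "q \<le> M2 \<Longrightarrow> v M1 q = 0"
  "p \<le> M1 \<Longrightarrow> v p 0 = 0" "p \<le> M1 \<Longrightarrow> v p M2 = 0"
  using v by (auto simp: vanishes_on_boundary_def)

text \<open>The boundary lines \<open>p = 0\<close> and \<open>p = M1\<close> are included: the sum
  is zero there, which lets the kernel formula in the first index be applied to the result.\<close>

lemma compact_y_kernel:
  assumes "p \<le> M1"
  shows "compact_y \<beta> M2 v p j = (\<Sum>q\<in>{1..<M2}. compact_kernel \<beta> j q * v p q)"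
  unfolding compact_y_transpose
  by (rule compact_x_kernel) (use j assms in \<open>auto simp: boundary_values\<close>)

lemma delta_y_kernel:
  assumes "p \<le> M1"
  shows "delta_y \<kappa> \<beta> h M2 v p j = - (\<Sum>q\<in>{1..<M2}. frac_kernel \<kappa> \<beta> h j q * v p q)"
  unfolding delta_y_transpose
  by (rule delta_x_kernel) (use j assms in \<open>auto simp: boundary_values\<close>)

lemma compact_x_compact_y:
  "compact_x \<alpha> M1 (compact_y \<beta> M2 v) i j
     = tensor_apply {1..<M1} {1..<M2} (compact_kernel \<alpha>) (compact_kernel \<beta>) v i j"
  by (subst compact_x_kernel[OF i])
    (auto simp: compact_y_kernel boundary_values tensor_apply_def sum_distrib_left mult.assoc)

lemma delta_x_delta_y:
  "delta_x \<kappa> \<alpha> h M1 (delta_y \<kappa>' \<beta> h' M2 v) i j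
     = tensor_apply {1..<M1} {1..<M2} (frac_kernel \<kappa> \<alpha> h) (frac_kernel \<kappa>' \<beta> h') v i j"
  by (subst delta_x_kernel[OF i])
    (auto simp: delta_y_kernel boundary_values tensor_apply_def sum_distrib_left mult.assoc sum_negf)

lemma compact_x_delta_y:
  "compact_x \<alpha> M1 (delta_y \<kappa> \<beta> h M2 v) i j
     = - tensor_apply {1..<M1} {1..<M2} (compact_kernel \<alpha>) (frac_kernel \<kappa> \<beta> h) v i j"
  by (subst compact_x_kernel[OF i])
    (auto simp: delta_y_kernel boundary_values tensor_apply_def sum_distrib_left mult.assoc sum_negf)

text \<open>Here the outer operator acts in the second index, so the sums appear in the opposite
  order and are exchanged at the end.\<close>

lemma compact_y_delta_x:
  "compact_y \<beta> M2 (delta_x \<kappa> \<alpha> h M1 v) i j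
     = - tensor_apply {1..<M1} {1..<M2} (frac_kernel \<kappa> \<alpha> h) (compact_kernel \<beta>) v i j"
proof -
  have dx: "delta_x \<kappa> \<alpha> h M1 v i q = - (\<Sum>p\<in>{1..<M1}. frac_kernel \<kappa> \<alpha> h i p * v p q)"
    if "q \<le> M2" for q
    by (rule delta_x_kernel) (use i that in \<open>auto simp: boundary_values\<close>)
  have "compact_y \<beta> M2 (delta_x \<kappa> \<alpha> h M1 v) i j
      = (\<Sum>q\<in>{1..<M2}. compact_kernel \<beta> j q * delta_x \<kappa> \<alpha> h M1 v i q)"
    unfolding compact_y_transpose
    by (rule compact_x_kernel) (use j in \<open>auto simp: dx boundary_values\<close>)
  also have "\<dots> = - (\<Sum>q\<in>{1..<M2}. \<Sum>p\<in>{1..<M1}.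
      frac_kernel \<kappa> \<alpha> h i p * compact_kernel \<beta> j q * v p q)"
    by (simp add: dx sum_distrib_left sum_negf mult_ac)
  finally show ?thesis
    unfolding tensor_apply_def by (subst sum.swap) simp
qed

end

section \<open>Stability\<close>

text \<open>Turns growth of squared energies into a growth factor for their roots. Division by
  \<open>y\<close> is avoided: if the claim failed then \<open>p < y\<close>, and
  \<open>p * p\<close> could be raised to \<open>p * y\<close>.\<close>

lemma le_of_square_le_add:
  fixes y p e :: real
  assumes "0 \<le> y" "0 \<le> p" "0 \<le> e" and le: "y\<^sup>2 \<le> p\<^sup>2 + e * p * y"
  shows "y \<le> (1 + e) * p"
proof (rule ccontr)
  assume less: "\<not> ?thesis"
  have "p \<le> (1 + e) * p"
    using assms by (simp add: algebra_simps)
  then have py: "p < y" using less by linarith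
  then have "((1 + e) * p) * y < y * y"
    using less assms by (intro mult_strict_right_mono) auto
  moreover have "p * p \<le> p * y"
    using py assms by (intro mult_left_mono) auto
  ultimately show False
    using le by (simp add: algebra_simps power2_eq_square)
qed

text \<open>The time-stepping argument freed from the grid. \<open>first\<close> and
  \<open>step\<close> are the tested error equations without diffusion, and the weights 1 and 4/9 of
  \<open>C\<close> are \<open>(sigma n)\<^sup>2\<close>.\<close>

lemma bdf2_stability:
  fixes A C S :: "('a \<Rightarrow> 'b \<Rightarrow> real) \<Rightarrow> ('a \<Rightarrow> 'b \<Rightarrow> real) \<Rightarrow> real"
    and E G :: "nat \<Rightarrow> 'a \<Rightarrow> 'b \<Rightarrow> real"
  assumes psd: "psd_form A" "psd_form C" "psd_form S"
    and lower: "\<And>v. 4 / 9 * S v v \<le> A v v" and upper: "\<And>v. A v v \<le> S v v"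
    and \<tau>: "0 \<le> \<tau>" "0 \<le> L" "9 * (\<tau> * L) \<le> 1"
    and first: "A (\<lambda>i j. E 1 i j - E 0 i j) (E 1) + \<tau>\<^sup>2 * C (\<lambda>i j. E 1 i j - E 0 i j) (E 1)
        \<le> \<tau> * A (G 1) (E 1)"
    and first_source: "S (G 1) (G 1) \<le> L\<^sup>2 * S (E 0) (E 0)"
    and step: "\<And>n. 2 \<le> n \<Longrightarrow> n \<le> N \<Longrightarrow>
        A (\<lambda>i j. 3 / 2 * E n i j - 2 * E (n - 1) i j + 1 / 2 * E (n - 2) i j) (E n)
        + 4 / 9 * \<tau>\<^sup>2 * C (\<lambda>i j. 3 / 2 * E n i j - 2 * E (n - 1) i j + 1 / 2 * E (n - 2) i j) (E n)
        \<le> \<tau> * A (G n) (E n)"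
    and step_source: "\<And>n. 2 \<le> n \<Longrightarrow> n \<le> N \<Longrightarrow> S (G n) (G n)
        \<le> L\<^sup>2 * S (\<lambda>i j. 2 * E (n - 1) i j - E (n - 2) i j) (\<lambda>i j. 2 * E (n - 1) i j - E (n - 2) i j)"
    and n: "1 \<le> n" "n \<le> N"
  shows "sqrt (S (E n) (E n)) \<le> 3 * exp (6 * L * (real n * \<tau>)) * sqrt (S (E 0) (E 0) + \<tau>\<^sup>2 * C (E 0) (E 0))"
proof -
  interpret A: psd_form A by fact
  interpret C: psd_form C by fact
  interpret S: psd_form S by fact
  \<comment> \<open>\<open>V\<close> is the natural product of the Euler step and \<open>W\<close>
    that of the BDF2 steps; \<open>WV\<close> passes from the one to the other.\<close>
  define V where "V = (\<lambda>v w. A v w + \<tau>\<^sup>2 * C v w)"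
  define W where "W = (\<lambda>v w. A v w + 4 / 9 * \<tau>\<^sup>2 * C v w)"
  interpret V: psd_form V
    unfolding V_def by (rule psd_form_add_scaled[OF psd(1,2)]) simp
  interpret W: psd_form W
    unfolding W_def by (rule psd_form_add_scaled[OF psd(1,2)]) simp
  define R where "R = sqrt (S (E 0) (E 0) + \<tau>\<^sup>2 * C (E 0) (E 0))"
  have R0: "0 \<le> R"
    by (simp add: R_def S.nonneg C.nonneg)
  have R2: "R\<^sup>2 = S (E 0) (E 0) + \<tau>\<^sup>2 * C (E 0) (E 0)"
    by (simp add: R_def S.nonneg C.nonneg)
  have AW: "A v v \<le> W v v" and WV: "W v v \<le> V v v" and AV: "A v v \<le> V v v" for v
    using C.nonneg[of v] mult_nonneg_nonneg[OF zero_le_power2[of \<tau>] C.nonneg[of v]]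
    by (auto simp: W_def V_def)
  have SW: "sqrt (S v v) \<le> 3 / 2 * sqrt (W v v)" for v
  proof -
    have "S v v \<le> 9 / 4 * W v v"
      using lower[of v] AW[of v] by linarith
    then have "sqrt (S v v) \<le> sqrt ((3 / 2)\<^sup>2 * W v v)"
      by (intro real_sqrt_le_mono) (simp add: power2_eq_square)
    then show ?thesis
      by (simp add: real_sqrt_mult)
  qed
  have source: "A f v \<le> sqrt (S f f) * sqrt (A v v)" for f v
  proof -
    have "A f v \<le> sqrt (A f f) * sqrt (A v v)"
      by (rule A.cauchy_schwarz_sqrt)
    also have "\<dots> \<le> sqrt (S f f) * sqrt (A v v)"
      by (intro mult_right_mono real_sqrt_le_mono upper) (simp add: A.nonneg)
    finally show ?thesis .
  qed
  define y where "y n = sqrt (W.bdf2_energy (E n) (E (n - 1)))" for n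
  have y0: "0 \<le> y n" for n
    by (simp add: y_def W.bdf2_energy_nonneg)
  have y2: "(y n)\<^sup>2 = W.bdf2_energy (E n) (E (n - 1))" for n
    by (simp add: y_def W.bdf2_energy_nonneg)
  have Wy: "sqrt (W (E n) (E n)) \<le> y n" for n
    unfolding y_def W.bdf2_energy_def by (simp add: W.nonneg)
  \<comment> \<open>With \<open>e\<close> at most 1/9, the Euler step gives
    \<open>x \<le> (1 + 2 * e) * R\<close>, at most \<open>11/9 * R\<close>; this bound is then fed
    back into the energy.\<close>
  have y_first: "y 1 \<le> 2 * R"
  proof -
    define x where "x = sqrt (V (E 1) (E 1))"
    define e where "e = \<tau> * L"
    define p where "p = V (E 1) (E 0)"
    define w where "w = V (E 0) (E 0)"
    have x0: "0 \<le> x" and x2: "x\<^sup>2 = V (E 1) (E 1)"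
      by (simp_all add: x_def V.nonneg)
    have e: "0 \<le> e" "e \<le> 1 / 9"
      using \<tau> by (auto simp: e_def)
    have wR: "w \<le> R\<^sup>2"
      using upper[of "E 0"] by (simp add: w_def V_def R2)
    have "sqrt (S (G 1) (G 1)) \<le> sqrt (L\<^sup>2 * S (E 0) (E 0))"
      using first_source by (rule real_sqrt_le_mono)
    also have "\<dots> = L * sqrt (S (E 0) (E 0))"
      using \<tau> by (simp add: real_sqrt_mult)
    also have "\<dots> \<le> L * R"
      using \<tau> unfolding R_def by (intro mult_left_mono real_sqrt_le_mono) (auto simp: C.nonneg)
    finally have SG: "sqrt (S (G 1) (G 1)) \<le> L * R" .
    have "x\<^sup>2 - p \<le> \<tau> * A (G 1) (E 1)"
    proof -
      have "x\<^sup>2 - p = V (\<lambda>i j. E 1 i j - E 0 i j) (E 1)"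
        using V.sym[of "E 0" "E 1"] by (simp add: V.lin_diff x2 p_def)
      then show ?thesis
        using first by (simp add: V_def)
    qed
    also have "\<dots> \<le> \<tau> * ((L * R) * x)"
    proof (intro mult_left_mono \<tau>)
      have "A (G 1) (E 1) \<le> sqrt (S (G 1) (G 1)) * sqrt (A (E 1) (E 1))"
        by (rule source)
      also have "\<dots> \<le> (L * R) * x"
        unfolding x_def using \<tau> R0
        by (intro mult_mono SG real_sqrt_le_mono AV) (auto simp: A.nonneg)
      finally show "A (G 1) (E 1) \<le> (L * R) * x" .
    qed
    finally have main: "x\<^sup>2 - p \<le> e * R * x"
      by (simp add: e_def mult_ac)
    have "0 \<le> V (\<lambda>i j. 1 * E 1 i j + (-1) * E 0 i j) (\<lambda>i j. 1 * E 1 i j + (-1) * E 0 i j)"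
      by (rule V.nonneg)
    then have "2 * p \<le> x\<^sup>2 + w"
      unfolding V.square_comb by (simp add: x2 p_def w_def)
    then have "x\<^sup>2 \<le> R\<^sup>2 + (2 * e) * R * x"
      using main wR by linarith
    then have "x \<le> (1 + 2 * e) * R"
      using x0 R0 e by (intro le_of_square_le_add) auto
    also have "\<dots> \<le> 11 / 9 * R"
      using e R0 by (intro mult_right_mono) auto
    finally have xR: "x \<le> 11 / 9 * R" .
    have "e * R * x \<le> 1 / 9 * R * (11 / 9 * R)"
      using e R0 x0 xR by (intro mult_mono) auto
    then have eRx: "e * R * x \<le> 11 / 81 * R\<^sup>2"
      by (simp add: power2_eq_square)
    have "(y 1)\<^sup>2 \<le> V (E 1) (E 1) + V (\<lambda>i j. 2 * E 1 i j - E 0 i j) (\<lambda>i j. 2 * E 1 i j - E 0 i j)"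
      unfolding y2 W.bdf2_energy_def using WV by (simp add: add_mono)
    also have "\<dots> = 5 * x\<^sup>2 - 4 * p + w"
      unfolding V.extrapolation_square by (simp add: x2 p_def w_def)
    \<comment> \<open>The left side is \<open>x\<^sup>2 + 4 * (x\<^sup>2 - p) + w\<close>, at most
      \<open>2 * R\<^sup>2 + 6 * e * R * x\<close>, and \<open>6 * 11/81 < 2\<close>.\<close>
    also have "\<dots> \<le> 4 * R\<^sup>2"
      using main eRx wR \<open>x\<^sup>2 \<le> R\<^sup>2 + (2 * e) * R * x\<close> zero_le_power2[of R] by linarith
    finally have "(y 1)\<^sup>2 \<le> (2 * R)\<^sup>2"
      by (simp add: power_mult_distrib)
    then show ?thesis
      by (rule power2_le_imp_le) (use R0 in simp)
  qed
  have y_step: "y n \<le> (1 + 6 * L * \<tau>) * y (n - 1)" if n: "2 \<le> n" "n \<le> N" for n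
  proof (rule le_of_square_le_add)
    let ?x = "\<lambda>i j. 2 * E (n - 1) i j - E (n - 2) i j"
    have n1: "n - 1 - 1 = n - 2" by simp
    have "sqrt (S (G n) (G n)) \<le> sqrt (L\<^sup>2 * S ?x ?x)"
      using step_source[OF n] by (rule real_sqrt_le_mono)
    also have "\<dots> = L * sqrt (S ?x ?x)"
      using \<tau> by (simp add: real_sqrt_mult)
    \<comment> \<open>The extrapolated error is exactly the second component of the previous energy,
      so the source costs only \<open>y (n - 1)\<close>. This 3/2 and the 4 of
      \<open>bdf2_energy_step\<close> make the growth rate 6.\<close>
    also have "\<dots> \<le> L * (3 / 2 * y (n - 1))"
    proof (intro mult_left_mono \<tau>)
      have "sqrt (W ?x ?x) \<le> y (n - 1)"
        unfolding y_def W.bdf2_energy_def n1 by (simp add: W.nonneg)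
      then show "sqrt (S ?x ?x) \<le> 3 / 2 * y (n - 1)"
        using SW[of ?x] by linarith
    qed
    finally have SG: "sqrt (S (G n) (G n)) \<le> L * (3 / 2 * y (n - 1))" .
    have "A (G n) (E n) \<le> sqrt (S (G n) (G n)) * sqrt (A (E n) (E n))"
      by (rule source)
    also have "\<dots> \<le> (L * (3 / 2 * y (n - 1))) * y n"
      using SG order_trans[OF real_sqrt_le_mono[OF AW] Wy] \<tau> y0
      by (intro mult_mono) (auto simp: A.nonneg)
    finally have AG: "A (G n) (E n) \<le> (L * (3 / 2 * y (n - 1))) * y n" .
    have "(y n)\<^sup>2 - (y (n - 1))\<^sup>2
        \<le> 4 * W (\<lambda>i j. 3 / 2 * E n i j - 2 * E (n - 1) i j + 1 / 2 * E (n - 2) i j) (E n)"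
      unfolding y2 n1 by (rule W.bdf2_energy_step)
    also have "\<dots> \<le> 4 * (\<tau> * A (G n) (E n))"
      using step[OF n] by (simp add: W_def)
    also have "\<dots> \<le> 4 * (\<tau> * ((L * (3 / 2 * y (n - 1))) * y n))"
      using AG \<tau> by (intro mult_left_mono) auto
    finally show "(y n)\<^sup>2 \<le> (y (n - 1))\<^sup>2 + (6 * L * \<tau>) * y (n - 1) * y n"
      by (simp add: algebra_simps)
  qed (use y0 \<tau> in auto)
  have y_bound: "y n \<le> exp (6 * L * \<tau>) ^ n * (2 * R)" if "1 \<le> n" "n \<le> N" for n
    using that
  proof (induction n rule: dec_induct)
    case base
    have "2 * R \<le> exp (6 * L * \<tau>) * (2 * R)"
      using R0 \<tau> mult_right_mono[of 1 "exp (6 * L * \<tau>)" "2 * R"] by simp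
    then show ?case using y_first by simp
  next
    case (step m)
    have "y (Suc m) \<le> (1 + 6 * L * \<tau>) * y m"
      using y_step[of "Suc m"] step by simp
    also have "\<dots> \<le> exp (6 * L * \<tau>) * y m"
      using y0 by (intro mult_right_mono exp_ge_add_one_self)
    also have "\<dots> \<le> exp (6 * L * \<tau>) * (exp (6 * L * \<tau>) ^ m * (2 * R))"
      using step by (intro mult_left_mono) auto
    finally show ?case by (simp add: mult_ac)
  qed
  have "sqrt (S (E n) (E n)) \<le> 3 / 2 * y n"
    using SW[of "E n"] Wy[of n] by linarith
  also have "\<dots> \<le> 3 * exp (6 * L * \<tau>) ^ n * R"
    using y_bound[OF n] by (simp add: mult_ac)
  also have "exp (6 * L * \<tau>) ^ n = exp (6 * L * (real n * \<tau>))"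
    by (simp add: exp_of_nat_mult[symmetric] mult_ac)
  finally show ?thesis
    by (simp add: R_def)
qed

section \<open>From the scheme to the abstract estimate\<close>

lemma scheme_error_equation:
  fixes u u' :: "nat \<Rightarrow> grid_fun"
  assumes sol: "scheme_solution a c hx hy \<tau> M1 M2 N \<alpha> \<beta> \<kappa>1 \<kappa>2 g u"
      "scheme_solution a c hx hy \<tau> M1 M2 N \<alpha> \<beta> \<kappa>1 \<kappa>2 g u'"
    and n: "n \<in> {1..N}" and ij: "i \<in> {1..<M1}" "j \<in> {1..<M2}"
    and E: "\<And>m. E m = (\<lambda>i j. u m i j - u' m i j)"
    and G: "G = (\<lambda>i j. lin_source g a c hx hy \<tau> u n i j - lin_source g a c hx hy \<tau> u' n i j)"
    and bdry: "\<And>m. m \<le> n \<Longrightarrow> vanishes_on_boundary M1 M2 (E m)" "vanishes_on_boundary M1 M2 G"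
  defines "Ax \<equiv> compact_kernel \<alpha>" and "Ay \<equiv> compact_kernel \<beta>"
    and "P \<equiv> frac_kernel \<kappa>1 \<alpha> hx" and "Q \<equiv> frac_kernel \<kappa>2 \<beta> hy"
  shows "tensor_apply {1..<M1} {1..<M2} Ax Ay (bdf2 \<tau> E n) i j
       + \<tau>\<^sup>2 * (sigma n)\<^sup>2 * tensor_apply {1..<M1} {1..<M2} P Q (bdf2 \<tau> E n) i j
     = tensor_apply {1..<M1} {1..<M2} Ax Ay G i j
       - tensor_apply {1..<M1} {1..<M2} P Ay (E n) i j - tensor_apply {1..<M1} {1..<M2} Ax Q (E n) i j"
proof -
  have D: "bdf2 \<tau> E n = (\<lambda>i j. bdf2 \<tau> u n i j - bdf2 \<tau> u' n i j)"
    by (auto simp: bdf2_def E fun_eq_iff diff_divide_distrib add_divide_distrib algebra_simps)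
  have D_bdry: "vanishes_on_boundary M1 M2 (bdf2 \<tau> E n)"
    using bdry(1)[of n] bdry(1)[of "n - 1"] bdry(1)[of "n - 2"] bdry(1)[of 0] n
    unfolding vanishes_on_boundary_def bdf2_def by auto
  have eq: "compact_x \<alpha> M1 (compact_y \<beta> M2 (bdf2 \<tau> w n)) i j
      + \<tau>\<^sup>2 * (sigma n)\<^sup>2 * delta_x \<kappa>1 \<alpha> hx M1 (delta_y \<kappa>2 \<beta> hy M2 (bdf2 \<tau> w n)) i j
      = compact_y \<beta> M2 (delta_x \<kappa>1 \<alpha> hx M1 (w n)) i j + compact_x \<alpha> M1 (delta_y \<kappa>2 \<beta> hy M2 (w n)) i j
        + compact_x \<alpha> M1 (compact_y \<beta> M2 (lin_source g a c hx hy \<tau> w n)) i j"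
    if "scheme_solution a c hx hy \<tau> M1 M2 N \<alpha> \<beta> \<kappa>1 \<kappa>2 g w" for w
    using that n ij unfolding scheme_solution_def Let_def by auto
  have "compact_x \<alpha> M1 (compact_y \<beta> M2 (bdf2 \<tau> E n)) i j
      + \<tau>\<^sup>2 * (sigma n)\<^sup>2 * delta_x \<kappa>1 \<alpha> hx M1 (delta_y \<kappa>2 \<beta> hy M2 (bdf2 \<tau> E n)) i j
      = compact_y \<beta> M2 (delta_x \<kappa>1 \<alpha> hx M1 (E n)) i j + compact_x \<alpha> M1 (delta_y \<kappa>2 \<beta> hy M2 (E n)) i j
        + compact_x \<alpha> M1 (compact_y \<beta> M2 G) i j"
    unfolding D E[of n] G compact_x_diff compact_y_diff delta_x_diff delta_y_diff
    using eq[OF sol(1)] eq[OF sol(2)] by (simp add: right_diff_distrib)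
  \<comment> \<open>Each fractional difference is minus a kernel: the product of two keeps its plus
    sign, while the single diffusion terms become negative.\<close>
  then show ?thesis
    unfolding Ax_def Ay_def P_def Q_def
      compact_x_compact_y[OF D_bdry ij] delta_x_delta_y[OF D_bdry ij]
      compact_x_compact_y[OF bdry(2) ij]
      compact_y_delta_x[OF bdry(1)[OF order_refl] ij] compact_x_delta_y[OF bdry(1)[OF order_refl] ij]
    by simp
qed

lemma node_mem:
  assumes "x0 \<le> x1" "h = (x1 - x0) / real M" "0 < M" "i \<le> M"
  shows "node x0 h i \<in> {x0..x1}"
proof -
  have "real i * h \<le> real M * h"
    using assms by (intro mult_right_mono) auto
  also have "\<dots> = x1 - x0"
    using assms by simp
  finally show ?thesis
    using assms by (simp add: node_def)
qed

theorem theorem3p1: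
  fixes a b c d T L \<alpha> \<beta> \<kappa>1 \<kappa>2 \<nu> hx hy \<tau> :: real
    and M1 M2 N :: nat
    and g :: "real \<Rightarrow> real \<Rightarrow> real \<Rightarrow> real \<Rightarrow> real"
    and u u' E :: "nat \<Rightarrow> grid_fun"
  assumes "1 < \<alpha>" "\<alpha> < 2" "1 < \<beta>" "\<beta> < 2" "0 < \<kappa>1" "0 < \<kappa>2"
    and "a < b" "c < d" "0 < T" "0 < L"
    and lipschitz: "\<And>x y t p q. x \<in> {a..b} \<Longrightarrow> y \<in> {c..d} \<Longrightarrow> t \<in> {0..T} \<Longrightarrow>
                      \<bar>g x y t p - g x y t q\<bar> \<le> L * \<bar>p - q\<bar>"
    and "0 < M1" "0 < M2" "0 < N"
    and "hx = (b - a) / real M1" "hy = (d - c) / real M2" "\<tau> = T / real N"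
    and "0 < \<nu>" "\<nu> < 1"
    and "0 < \<tau>" "\<tau> \<le> (1 - \<nu>) / (9 * L)"
    and "scheme_solution a c hx hy \<tau> M1 M2 N \<alpha> \<beta> \<kappa>1 \<kappa>2 g u"
    and "scheme_solution a c hx hy \<tau> M1 M2 N \<alpha> \<beta> \<kappa>1 \<kappa>2 g u'"
    and "vanishes_on_boundary M1 M2 (u 0)" "vanishes_on_boundary M1 M2 (u' 0)"
    and "E = (\<lambda>n i j. u n i j - u' n i j)"
  shows "\<forall>n\<in>{1..N}.
           grid_norm hx hy M1 M2 (E n)
           \<le> 3 / \<nu> * exp (18 / \<nu> * L * T) *
             grid_norm hx hy M1 M2
               (\<lambda>i j. E 0 i j
                  + 23 / 18 * \<tau>\<^sup>2 * delta_x \<kappa>1 \<alpha> hx M1 (delta_y \<kappa>2 \<beta> hy M2 (E 0)) i j)"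
proof -
  let ?I = "{1..<M1}" and ?J = "{1..<M2}"
  have \<alpha>\<beta>: "0 < \<alpha>" "\<alpha> < 2" "0 < \<beta>" "\<beta> < 2"
    using assms(1-4) by auto
  define Ax where "Ax = compact_kernel \<alpha>"
  define Ay where "Ay = compact_kernel \<beta>"
  define P where "P = frac_kernel \<kappa>1 \<alpha> hx"
  define Q where "Q = frac_kernel \<kappa>2 \<beta> hy"
  define A where "A = tensor_form ?I ?J Ax Ay"
  define C where "C = tensor_form ?I ?J P Q"
  define S where "S = tensor_form ?I ?J id_kernel id_kernel"
  define G where "G n = (\<lambda>i j. lin_source g a c hx hy \<tau> u n i j - lin_source g a c hx hy \<tau> u' n i j)" for n
  have dd: "diag_dominant ?I Ax" "diag_dominant ?J Ay" "diag_dominant ?I P" "diag_dominant ?J Q"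
    unfolding Ax_def Ay_def P_def Q_def
    by (intro diag_dominant_compact diag_dominant_frac_kernel less_imp_le[of 0] \<alpha>\<beta> assms(5,6))+
  have psd: "psd_form A" "psd_form C" "psd_form S"
    "psd_form (tensor_form ?I ?J P Ay)" "psd_form (tensor_form ?I ?J Ax Q)"
    unfolding A_def C_def S_def by (intro psd_tensor_form dd diag_dominant_id_kernel; simp)+
  interpret A: psd_form A by fact
  interpret C: psd_form C by fact
  have S_eq: "S v w = (\<Sum>i\<in>?I. \<Sum>j\<in>?J. v i j * w i j)" for v w
    by (simp add: S_def tensor_form_id)
  have E: "E m = (\<lambda>i j. u m i j - u' m i j)" for m
    by (simp add: assms(26))
  have bdry_u: "vanishes_on_boundary M1 M2 (u m)" "vanishes_on_boundary M1 M2 (u' m)" if "m \<le> N" for m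
    using assms(22-25) that unfolding scheme_solution_def Let_def by (cases m; simp)+
  have bdry_E: "vanishes_on_boundary M1 M2 (E m)" if "m \<le> N" for m
    using bdry_u[OF that] unfolding E vanishes_on_boundary_def by simp
  \<comment> \<open>Both solutions vanish on the boundary, so \<open>g\<close> is evaluated there at
    identical arguments and the difference is zero whatever the values of \<open>g\<close>.\<close>
  have bdry_G: "vanishes_on_boundary M1 M2 (G n)" if "n \<in> {1..N}" for n
  proof -
    have zero: "u m i j = 0" "u' m i j = 0"
      if "m \<le> N" "i \<le> M1" "j \<le> M2" "i = 0 \<or> i = M1 \<or> j = 0 \<or> j = M2" for m i j
      using bdry_u[OF that(1)] that unfolding vanishes_on_boundary_def by blast+
    have "n - 1 \<le> N" "n - 2 \<le> N"
      using that by auto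
    then show ?thesis
      unfolding vanishes_on_boundary_def G_def lin_source_def
      by (intro allI impI) (simp only: zero le0 diff_self)
  qed
  have time_mem: "node 0 \<tau> n \<in> {0..T}" if "n \<le> N" for n
    using assms(9,14,17) that by (intro node_mem) auto
  have G_bound: "\<bar>G n i j\<bar> \<le> L * \<bar>if n = 1 then E 0 i j else 2 * E (n - 1) i j - E (n - 2) i j\<bar>"
    if "n \<le> N" "i \<in> ?I" "j \<in> ?J" for n i j
  proof -
    have "node a hx i \<in> {a..b}" "node c hy j \<in> {c..d}"
      using node_mem[OF less_imp_le[OF assms(7)] assms(15,12), of i]
        node_mem[OF less_imp_le[OF assms(8)] assms(16,13), of j] that by auto
    from lipschitz[OF this time_mem[OF that(1)]] show ?thesis
      unfolding G_def lin_source_def E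
      by (rule order_trans) (auto intro!: arg_cong[where f = abs] eq_refl simp: algebra_simps)
  qed
  have G_source: "S (G n) (G n) \<le> L\<^sup>2 * S w w"
    if "n \<le> N" "w = (if n = 1 then E 0 else (\<lambda>i j. 2 * E (n - 1) i j - E (n - 2) i j))" for n w
    unfolding S_eq sum_distrib_left
  proof (intro sum_mono)
    fix i j assume ij: "i \<in> ?I" "j \<in> ?J"
    have "\<bar>G n i j\<bar> \<le> \<bar>L * w i j\<bar>"
      using G_bound[OF that(1) ij] that(2) \<open>0 < L\<close> by (simp add: abs_mult split: if_splits)
    then show "G n i j * G n i j \<le> L\<^sup>2 * (w i j * w i j)"
      unfolding abs_le_square_iff by (simp add: power2_eq_square mult_ac)
  qed
  have energy: "A (bdf2 \<tau> E n) (E n) + \<tau>\<^sup>2 * (sigma n)\<^sup>2 * C (bdf2 \<tau> E n) (E n) \<le> A (G n) (E n)"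
    if n: "n \<in> {1..N}" for n
  proof -
    have "A (bdf2 \<tau> E n) (E n) + \<tau>\<^sup>2 * (sigma n)\<^sup>2 * C (bdf2 \<tau> E n) (E n)
        = (\<Sum>i\<in>?I. \<Sum>j\<in>?J. (tensor_apply ?I ?J Ax Ay (bdf2 \<tau> E n) i j
            + \<tau>\<^sup>2 * (sigma n)\<^sup>2 * tensor_apply ?I ?J P Q (bdf2 \<tau> E n) i j) * E n i j)"
      by (simp add: A_def C_def tensor_form_def sum_distrib_left sum.distrib algebra_simps)
    also have "\<dots> = (\<Sum>i\<in>?I. \<Sum>j\<in>?J. (tensor_apply ?I ?J Ax Ay (G n) i j
        - tensor_apply ?I ?J P Ay (E n) i j - tensor_apply ?I ?J Ax Q (E n) i j) * E n i j)"
    proof (intro sum.cong refl)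
      fix i j assume ij: "i \<in> ?I" "j \<in> ?J"
      have "vanishes_on_boundary M1 M2 (E m)" if "m \<le> n" for m
        using bdry_E that n by auto
      from scheme_error_equation[OF assms(22,23) n ij E G_def this bdry_G[OF n]]
      show "(tensor_apply ?I ?J Ax Ay (bdf2 \<tau> E n) i j
            + \<tau>\<^sup>2 * (sigma n)\<^sup>2 * tensor_apply ?I ?J P Q (bdf2 \<tau> E n) i j) * E n i j
          = (tensor_apply ?I ?J Ax Ay (G n) i j
            - tensor_apply ?I ?J P Ay (E n) i j - tensor_apply ?I ?J Ax Q (E n) i j) * E n i j"
        unfolding Ax_def Ay_def P_def Q_def by simp
    qed
    also have "\<dots> = A (G n) (E n) - tensor_form ?I ?J P Ay (E n) (E n) - tensor_form ?I ?J Ax Q (E n) (E n)"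
      by (simp add: A_def tensor_form_def sum_subtractf left_diff_distrib)
    also have "\<dots> \<le> A (G n) (E n)"
      using psd_form.nonneg[OF psd(4), of "E n"] psd_form.nonneg[OF psd(5), of "E n"] by linarith
    finally show ?thesis .
  qed
  \<comment> \<open>Multiplying by \<open>\<tau>\<close> clears the denominator of
    \<open>bdf2\<close>, leaving the weights 3/2, -2, 1/2 for \<open>n\<close> at least 2.\<close>
  have scaled_energy: "A D (E n) + \<tau>\<^sup>2 * (sigma n)\<^sup>2 * C D (E n) \<le> \<tau> * A (G n) (E n)"
    if n: "n \<in> {1..N}" and D: "D = (\<lambda>i j. \<tau> * bdf2 \<tau> E n i j)" for n D
    using mult_left_mono[OF energy[OF n] less_imp_le[OF \<open>0 < \<tau>\<close>]]
    unfolding D A.lin_scale C.lin_scale by (simp add: algebra_simps)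
  have stable: "sqrt (S (E n) (E n))
      \<le> 3 * exp (6 * L * (real n * \<tau>)) * sqrt (S (E 0) (E 0) + \<tau>\<^sup>2 * C (E 0) (E 0))"
    if n: "n \<in> {1..N}" for n
  proof (rule bdf2_stability[OF psd(1-3), where G = G and N = N])
    show "4 / 9 * S v v \<le> A v v" "A v v \<le> S v v" for v
      unfolding S_def A_def Ax_def Ay_def by (intro compact_form_bounds \<alpha>\<beta>)+
    show "9 * (\<tau> * L) \<le> 1"
      using \<open>\<tau> \<le> (1 - \<nu>) / (9 * L)\<close> \<open>0 < L\<close> \<open>0 < \<nu>\<close> by (simp add: field_simps)
    show "A (\<lambda>i j. E 1 i j - E 0 i j) (E 1) + \<tau>\<^sup>2 * C (\<lambda>i j. E 1 i j - E 0 i j) (E 1) \<le> \<tau> * A (G 1) (E 1)"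
      using scaled_energy[of 1 "\<lambda>i j. E 1 i j - E 0 i j"] \<open>0 < \<tau>\<close> \<open>0 < N\<close>
      by (simp add: bdf2_def sigma_def)
    show "S (G 1) (G 1) \<le> L\<^sup>2 * S (E 0) (E 0)"
      using \<open>0 < N\<close> by (intro G_source) auto
  next
    fix m assume m: "2 \<le> m" "m \<le> N"
    let ?D = "\<lambda>i j. 3 / 2 * E m i j - 2 * E (m - 1) i j + 1 / 2 * E (m - 2) i j"
    have "?D = (\<lambda>i j. \<tau> * bdf2 \<tau> E m i j)"
      using m \<open>0 < \<tau>\<close> by (auto simp: bdf2_def fun_eq_iff field_simps)
    then show "A ?D (E m) + 4 / 9 * \<tau>\<^sup>2 * C ?D (E m) \<le> \<tau> * A (G m) (E m)"
      using scaled_energy[of m ?D] m by (simp add: sigma_def power_divide mult_ac)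
    show "S (G m) (G m) \<le> L\<^sup>2 * S (\<lambda>i j. 2 * E (m - 1) i j - E (m - 2) i j) (\<lambda>i j. 2 * E (m - 1) i j - E (m - 2) i j)"
      using m by (intro G_source) auto
  qed (use n \<open>0 < \<tau>\<close> \<open>0 < L\<close> in auto)
  let ?F = "\<lambda>i j. E 0 i j + 23 / 18 * \<tau>\<^sup>2 * delta_x \<kappa>1 \<alpha> hx M1 (delta_y \<kappa>2 \<beta> hy M2 (E 0)) i j"
  \<comment> \<open>Expanding the square of \<open>?F\<close>, the cross term is
    \<open>2 * 23/18 = 23/9\<close> times the nonnegative
    \<open>\<tau>\<^sup>2 * C (E 0) (E 0)\<close>; the remaining square is discarded.\<close>
  have initial: "S (E 0) (E 0) + \<tau>\<^sup>2 * C (E 0) (E 0) \<le> S ?F ?F"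
  proof -
    have "S (E 0) (E 0) + \<tau>\<^sup>2 * C (E 0) (E 0) \<le> S (E 0) (E 0) + 23 / 9 * \<tau>\<^sup>2 * C (E 0) (E 0)"
      using C.nonneg[of "E 0"] mult_nonneg_nonneg[OF zero_le_power2[of \<tau>] C.nonneg[of "E 0"]] by simp
    also have "\<dots> = (\<Sum>i\<in>?I. \<Sum>j\<in>?J. E 0 i j * E 0 i j
        + 23 / 9 * \<tau>\<^sup>2 * (tensor_apply ?I ?J P Q (E 0) i j * E 0 i j))"
      by (simp add: S_eq C_def tensor_form_def sum.distrib sum_distrib_left)
    also have "\<dots> \<le> S ?F ?F"
      unfolding S_eq
    proof (intro sum_mono)
      fix i j assume ij: "i \<in> ?I" "j \<in> ?J"
      let ?x = "tensor_apply ?I ?J P Q (E 0) i j"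
      have F: "?F i j = E 0 i j + 23 / 18 * \<tau>\<^sup>2 * ?x"
        using delta_x_delta_y[OF bdry_E ij] by (simp add: P_def Q_def)
      have "?F i j * ?F i j
          = E 0 i j * E 0 i j + 23 / 9 * \<tau>\<^sup>2 * (?x * E 0 i j) + (23 / 18 * \<tau>\<^sup>2 * ?x)\<^sup>2"
        unfolding F by (simp add: power2_eq_square algebra_simps)
      then show "E 0 i j * E 0 i j + 23 / 9 * \<tau>\<^sup>2 * (?x * E 0 i j) \<le> ?F i j * ?F i j"
        using zero_le_power2[of "23 / 18 * \<tau>\<^sup>2 * ?x"] by linarith
    qed
    finally show ?thesis .
  qed
  have norm_eq: "grid_norm hx hy M1 M2 v = sqrt (hx * hy) * sqrt (S v v)" for v
  proof -
    have "{1..M1 - 1} = ?I" "{1..M2 - 1} = ?J"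
      using \<open>0 < M1\<close> \<open>0 < M2\<close> by auto
    then show ?thesis
      by (simp add: grid_norm_def S_eq real_sqrt_mult power2_eq_square)
  qed
  have h: "0 \<le> hx * hy"
    using assms(7,8,15,16) by simp
  show ?thesis
  proof
    fix n assume n: "n \<in> {1..N}"
    \<comment> \<open>The constants of \<open>stable\<close> do not involve \<open>\<nu>\<close>;
      those of the claim follow from \<open>\<nu> < 1\<close>, as 3 is at most
      \<open>3 / \<nu>\<close> and 6 at most \<open>18 / \<nu>\<close>.\<close>
    have "real n * \<tau> \<le> T"
      using time_mem[of n] n by (simp add: node_def)
    then have "6 * L * (real n * \<tau>) \<le> 6 * L * T"
      using \<open>0 < L\<close> by (intro mult_left_mono) auto
    also have "\<dots> \<le> 18 / \<nu> * (L * T)"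
      using \<open>0 < \<nu>\<close> \<open>\<nu> < 1\<close> \<open>0 < L\<close> \<open>0 < T\<close>
      unfolding mult.assoc by (intro mult_right_mono) (auto simp: field_simps)
    finally have "exp (6 * L * (real n * \<tau>)) \<le> exp (18 / \<nu> * L * T)"
      by (simp add: mult.assoc)
    moreover have "3 \<le> 3 / \<nu>"
      using \<open>0 < \<nu>\<close> \<open>\<nu> < 1\<close> by (simp add: field_simps)
    ultimately have const: "3 * exp (6 * L * (real n * \<tau>)) \<le> 3 / \<nu> * exp (18 / \<nu> * L * T)"
      using \<open>0 < \<nu>\<close> by (intro mult_mono) auto
    have "sqrt (S (E n) (E n)) \<le> 3 / \<nu> * exp (18 / \<nu> * L * T) * sqrt (S ?F ?F)"
      using \<open>0 < \<nu>\<close> psd_form.nonneg[OF psd(3), of "E 0"] C.nonneg[of "E 0"]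
      by (intro order_trans[OF stable[OF n]] mult_mono const real_sqrt_le_mono initial) auto
    from mult_left_mono[OF this real_sqrt_ge_zero[OF h]]
    show "grid_norm hx hy M1 M2 (E n) \<le> 3 / \<nu> * exp (18 / \<nu> * L * T) * grid_norm hx hy M1 M2 ?F"
      unfolding norm_eq by (simp only: mult.left_commute)
  qed
qed

end
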